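(* For any graphs $G$ and $H$, $\mu_{\mathrm{int}}(G\odot H)\le \max\{\mu_{\mathrm{int}}(G),|V(H)|\}$.
   Context: Graphs are finite and simple (with nonempty vertex set). For graphs $G$ and $H$ with $V(G)=\{v_1,\dots,v_n\}$, the corona product $G\odot H$ is the graph obtained by taking $G$ and $n$ disjoint copies $H_1,\dots,H_n$ of $H$ and, for each $i\in\{1,\dots,n\}$, adding the edge $v_ix$ for every $x\in V(H_i)$. An improper interval coloring of a graph $G$ is an assignment of colors (natural numbers) to the edges of $G$, not necessarily proper, such that for every vertex $v$ the set of colors on the edges incident with $v$ is an integral interval (a set of consecutive integers). It is $k$-improper if at most $k$ edges with the same color all share a common endpoint, i.e. at each vertex each color appears on at most $k$ incident edges. The interval coloring impropriety $\mu_{\mathrm{int}}(G)$ is the smallest positive integer $k$ such that $G$ has a $k$-improper interval coloring. *)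

theory Defs
  imports Main
begin

record 'a graph =
  verts :: "'a set"
  edges :: "'a set set"

definition fin_simple_graph :: "'a graph \<Rightarrow> bool" where
  "fin_simple_graph G \<longleftrightarrow>
     finite (verts G) \<and> verts G \<noteq> {} \<and> (\<forall>e\<in>edges G. e \<subseteq> verts G \<and> card e = 2)"

(* Inl v is the vertex v of G; Inr (v, x) is the vertex x in the copy of H attached to v. *)
definition corona :: "'a graph \<Rightarrow> 'b graph \<Rightarrow> ('a + 'a \<times> 'b) graph" where
  "corona G H = \<lparr>
     verts = Inl ` verts G \<union> Inr ` (verts G \<times> verts H),
     edges = {Inl ` e | e. e \<in> edges G}
       \<union> {(\<lambda>x. Inr (v, x)) ` f | v f. v \<in> verts G \<and> f \<in> edges H}
       \<union> {{Inl v, Inr (v, x)} | v x. v \<in> verts G \<and> x \<in> verts H} \<rparr>"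

definition incident_edges :: "'a graph \<Rightarrow> 'a \<Rightarrow> 'a set set" where
  "incident_edges G v = {e \<in> edges G. v \<in> e}"

(* For a > b the interval {a..b} is empty, so isolated vertices impose no condition. *)
definition improper_interval_coloring :: "'a graph \<Rightarrow> ('a set \<Rightarrow> nat) \<Rightarrow> bool" where
  "improper_interval_coloring G c \<longleftrightarrow>
     (\<forall>v\<in>verts G. \<exists>a b. c ` incident_edges G v = {a..b})"

definition k_improper :: "nat \<Rightarrow> 'a graph \<Rightarrow> ('a set \<Rightarrow> nat) \<Rightarrow> bool" where
  "k_improper k G c \<longleftrightarrow>
     (\<forall>v\<in>verts G. \<forall>i. card {e \<in> incident_edges G v. c e = i} \<le> k)"

definition mu_int :: "'a graph \<Rightarrow> nat" where
  "mu_int G = (LEAST k. k \<ge> 1 \<and> (\<exists>c. improper_interval_coloring G c \<and> k_improper k G c))"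

lemma fin_simple_graph_finite_edges:
  assumes "fin_simple_graph G"
  shows "finite (edges G)"
  using assms finite_subset[of "edges G" "Pow (verts G)"]
  unfolding fin_simple_graph_def by blast

(* The set minimised in mu_int is nonempty: give every edge the same color. *)
lemma mu_int_exists:
  assumes "fin_simple_graph G"
  shows "\<exists>k\<ge>1. \<exists>c. improper_interval_coloring G c \<and> k_improper k G c"
proof -
  let ?c = "\<lambda>_. 0 :: nat"
  have "improper_interval_coloring G ?c"
    unfolding improper_interval_coloring_def
  proof
    fix v
    have "?c ` incident_edges G v = {0..0} \<or> ?c ` incident_edges G v = {1..0}"
      by auto
    then show "\<exists>a b. ?c ` incident_edges G v = {a..b}" by blast
  qed
  moreover have "k_improper (Suc (card (edges G))) G ?c"
    unfolding k_improper_def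
  proof (intro ballI allI)
    fix v i
    have "card {e \<in> incident_edges G v. ?c e = i} \<le> card (edges G)"
      by (rule card_mono[OF fin_simple_graph_finite_edges[OF assms]])
         (auto simp: incident_edges_def)
    then show "card {e \<in> incident_edges G v. ?c e = i} \<le> Suc (card (edges G))" by simp
  qed
  ultimately show ?thesis by (intro exI[of _ "Suc (card (edges G))"]) auto
qed

lemma fin_simple_graph_corona:
  assumes "fin_simple_graph G" "fin_simple_graph H"
  shows "fin_simple_graph (corona G H)"
proof -
  have card2: "card (Inl ` e) = 2" if "e \<in> edges G" for e
    using assms(1) that by (simp add: fin_simple_graph_def card_image)
  have card2': "card ((\<lambda>x. Inr (v, x)) ` f) = 2" if "f \<in> edges H" for v :: 'a and f
    using assms(2) that by (simp add: fin_simple_graph_def card_image inj_on_def)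
  have sub: "e \<subseteq> verts G" if "e \<in> edges G" for e
    using assms(1) that by (simp add: fin_simple_graph_def)
  have sub': "f \<subseteq> verts H" if "f \<in> edges H" for f
    using assms(2) that by (simp add: fin_simple_graph_def)
  have "e \<subseteq> verts (corona G H) \<and> card e = 2" if "e \<in> edges (corona G H)" for e
    using that card2 card2' sub sub' unfolding corona_def by fastforce
  moreover have "finite (verts (corona G H))" "verts (corona G H) \<noteq> {}"
    using assms by (auto simp: fin_simple_graph_def corona_def)
  ultimately show ?thesis by (simp add: fin_simple_graph_def)
qed

end

theory Submission
  imports Defs
begin

text \<open>
  Start from an improper interval coloring \<open>c\<close> of \<open>G\<close> that attains the impropriety of \<open>G\<close>. At each
  vertex \<open>v\<close> of \<open>G\<close> the colors form an interval, so there is an unused color that extends this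
  interval (lemma \<open>fresh_color_extending_interval\<close>). Give this one color to every edge that the
  corona adds at \<open>v\<close>: the edges from \<open>v\<close> to its copy of \<open>H\<close>, and the edges inside that copy.

  At \<open>v\<close> the interval grows by one color, which occurs \<open>|V(H)|\<close> times; the old colors
  keep their multiplicities. A vertex in the copy sees just one color, and its degree is at most
  \<open>|V(H)|\<close>, because it has at most \<open>|V(H)| - 1\<close> neighbours in the copy besides \<open>v\<close>.
\<close>

lemma mu_int_witness:
  assumes "fin_simple_graph G"
  obtains c where "improper_interval_coloring G c" "k_improper (mu_int G) G c" "mu_int G \<ge> 1"
  using LeastI_ex[OF mu_int_exists[OF assms]] unfolding mu_int_def by blast

lemma mu_int_le:
  assumes "k \<ge> 1" "improper_interval_coloring G c" "k_improper k G c"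
  shows "mu_int G \<le> k"
  unfolding mu_int_def using assms by (blast intro: Least_le)

text \<open>The extension is upwards, since an interval that starts at 0 has no room below. The empty
  set, which occurs at isolated vertices, is extended to a singleton.\<close>

lemma fresh_color_extending_interval:
  fixes a b :: nat
  shows "\<exists>m. m \<notin> {a..b} \<and> (\<exists>a' b'. insert m {a..b} = {a'..b'})"
proof (cases "a \<le> b")
  case True
  then have "insert (Suc b) {a..b} = {a..Suc b}" by auto
  then show ?thesis by (intro exI[of _ "Suc b"]) auto
next
  case False
  then have "insert 0 {a..b} = {0..0}" by auto
  moreover have "0 \<notin> {a..b}" using False by simp
  ultimately show ?thesis by blast
qed

text \<open>An edge of the corona either lies within \<open>G\<close> or meets exactly one copy of \<open>H\<close>; the vertex of
  \<open>G\<close> that owns this copy is the value of the definite description.\<close>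

definition corona_coloring ::
    "('a set \<Rightarrow> nat) \<Rightarrow> ('a \<Rightarrow> nat) \<Rightarrow> ('a + 'a \<times> 'b) set \<Rightarrow> nat" where
  "corona_coloring c m e =
     (if e \<subseteq> range Inl then c (Inl -` e) else m (THE v. \<exists>x. Inr (v, x) \<in> e))"

lemma corona_coloring_base [simp]: "corona_coloring c m (Inl ` e) = c e"
  by (auto simp: corona_coloring_def inj_vimage_image_eq)

lemma corona_coloring_added:
  assumes "Inr (v, x) \<in> e" "\<And>w y. Inr (w, y) \<in> e \<Longrightarrow> w = v"
  shows "corona_coloring c m e = m v"
proof -
  have "(THE w. \<exists>y. Inr (w, y) \<in> e) = v"
    using assms by (blast intro: the_equality)
  moreover have "\<not> e \<subseteq> range Inl" using assms(1) by auto
  ultimately show ?thesis by (simp add: corona_coloring_def)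
qed

lemma incident_edges_corona_Inl:
  assumes "v \<in> verts G"
  shows "incident_edges (corona G H) (Inl v) =
    (`) Inl ` incident_edges G v \<union> (\<lambda>x. {Inl v, Inr (v, x)}) ` verts H"
  using assms by (auto simp: incident_edges_def corona_def)

text \<open>The edges at a vertex \<open>x\<close> of a copy of \<open>H\<close> are indexed by \<open>V(H)\<close>: the edge to \<open>v\<close> takes
  the index \<open>x\<close>, which no neighbour of \<open>x\<close> in \<open>H\<close> occupies.\<close>

lemma incident_edges_corona_Inr:
  assumes "fin_simple_graph H"
  shows "incident_edges (corona G H) (Inr (v, x)) \<subseteq>
    (\<lambda>y. {if y = x then Inl v else Inr (v, y), Inr (v, x)}) ` verts H"
proof
  fix e assume "e \<in> incident_edges (corona G H) (Inr (v, x))"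
  then consider (copy) f where "f \<in> edges H" "x \<in> f" "e = (\<lambda>y. Inr (v, y)) ` f"
    | (link) "x \<in> verts H" "e = {Inl v, Inr (v, x)}"
    by (auto simp: incident_edges_def corona_def)
  then show "e \<in> (\<lambda>y. {if y = x then Inl v else Inr (v, y), Inr (v, x)}) ` verts H"
  proof cases
    case copy
    then have "card f = 2" "f \<subseteq> verts H" using assms by (auto simp: fin_simple_graph_def)
    with \<open>x \<in> f\<close> obtain y where "f = {y, x}" "y \<noteq> x" "y \<in> verts H"
      by (auto simp: card_2_iff)
    then show ?thesis using copy(3) by (intro image_eqI[of _ _ y]) auto
  next
    case link
    then show ?thesis by (intro image_eqI[of _ _ x]) auto
  qed
qed

theorem theorem24:
  fixes G :: "'a graph" and H :: "'b graph"
  assumes "fin_simple_graph G" and "fin_simple_graph H"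
  shows "mu_int (corona G H) \<le> max (mu_int G) (card (verts H))"
proof -
  have finH: "finite (verts H)" and neH: "verts H \<noteq> {}"
    using assms(2) by (auto simp: fin_simple_graph_def)
  obtain c where c: "improper_interval_coloring G c" "k_improper (mu_int G) G c"
    and pos: "mu_int G \<ge> 1"
    using mu_int_witness[OF assms(1)] .
  have "\<forall>v\<in>verts G. \<exists>m. m \<notin> c ` incident_edges G v \<and>
      (\<exists>a b. insert m (c ` incident_edges G v) = {a..b})"
  proof
    fix v assume "v \<in> verts G"
    then obtain a b where "c ` incident_edges G v = {a..b}"
      using c(1) unfolding improper_interval_coloring_def by blast
    then show "\<exists>m. m \<notin> c ` incident_edges G v \<and>
        (\<exists>a b. insert m (c ` incident_edges G v) = {a..b})"
      using fresh_color_extending_interval[of a b] by (simp only:)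
  qed
  from bchoice[OF this] obtain m where m: "\<forall>v\<in>verts G. m v \<notin> c ` incident_edges G v \<and>
      (\<exists>a b. insert (m v) (c ` incident_edges G v) = {a..b})" ..
  then have fresh: "c e \<noteq> m v" if "v \<in> verts G" "e \<in> incident_edges G v" for v e
    using that imageI[of e _ c] by fastforce
  have ext: "\<exists>a b. insert (m v) (c ` incident_edges G v) = {a..b}" if "v \<in> verts G" for v
    using m that by simp
  let ?K = "corona G H" and ?k = "max (mu_int G) (card (verts H))"
  let ?d = "corona_coloring c m :: ('a + 'a \<times> 'b) set \<Rightarrow> nat"
  have link: "?d {Inl v, Inr (v, x)} = m v" for v x
    by (rule corona_coloring_added) auto
  have copy: "?d e = m v" if "e \<in> incident_edges ?K (Inr (v, x))" for v x e
    using that incident_edges_corona_Inr[OF assms(2), of G v x]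
    by (intro corona_coloring_added[of v x]) (auto split: if_splits)
  have "(\<exists>a b. ?d ` incident_edges ?K u = {a..b}) \<and>
      (\<forall>i. card {e \<in> incident_edges ?K u. ?d e = i} \<le> ?k)" if "u \<in> verts ?K" for u
  proof (cases u)
    case (Inl v)
    with that have v: "v \<in> verts G" by (auto simp: corona_def)
    note inc = incident_edges_corona_Inl[OF v, of H]
    have "?d ` incident_edges ?K u = insert (m v) (c ` incident_edges G v)"
      using neH by (auto simp: Inl inc image_Un image_image link)
    moreover have "card {e \<in> incident_edges ?K u. ?d e = i} \<le> ?k" for i
    proof (cases "i = m v")
      case True
      have "{e \<in> incident_edges ?K u. ?d e = i} \<subseteq> (\<lambda>x. {Inl v, Inr (v, x)}) ` verts H"
        using fresh[OF v] True by (auto simp: Inl inc link)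
      then have "card {e \<in> incident_edges ?K u. ?d e = i} \<le> card (verts H)"
        using surj_card_le[OF finH] by blast
      then show ?thesis by simp
    next
      case False
      have "{e \<in> incident_edges ?K u. ?d e = i} \<subseteq>
          (`) Inl ` {e \<in> incident_edges G v. c e = i}"
        using False by (auto simp: Inl inc link)
      moreover have "finite {e \<in> incident_edges G v. c e = i}"
        using fin_simple_graph_finite_edges[OF assms(1)] by (simp add: incident_edges_def)
      ultimately have "card {e \<in> incident_edges ?K u. ?d e = i} \<le>
          card {e \<in> incident_edges G v. c e = i}"
        using surj_card_le by blast
      also have "\<dots> \<le> mu_int G" using c(2) v by (simp add: k_improper_def)
      finally show ?thesis by simp
    qed
    ultimately show ?thesis using ext[OF v] by simp
  next
    case (Inr p)
    then obtain v x where u: "u = Inr (v, x)" by (cases p) auto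
    with that have "v \<in> verts G" "x \<in> verts H" by (auto simp: corona_def)
    then have "{Inl v, Inr (v, x)} \<in> incident_edges ?K u"
      unfolding u incident_edges_def corona_def by simp blast
    then have "(\<lambda>_. m v) ` incident_edges ?K u = {m v}"
      by (rule image_constant)
    moreover have "?d ` incident_edges ?K u = (\<lambda>_. m v) ` incident_edges ?K u"
      by (rule image_cong[OF refl]) (rule copy, simp only: u)
    ultimately have single: "?d ` incident_edges ?K u = {m v..m v}" by simp
    have "card {e \<in> incident_edges ?K u. ?d e = i} \<le> card (verts H)" for i
    proof (rule surj_card_le[OF finH])
      show "{e \<in> incident_edges ?K u. ?d e = i} \<subseteq>
          (\<lambda>y. {if y = x then Inl v else Inr (v, y), Inr (v, x)}) ` verts H"
        using incident_edges_corona_Inr[OF assms(2), of G v x] unfolding u by blast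
    qed
    then have "card {e \<in> incident_edges ?K u. ?d e = i} \<le> ?k" for i
      by (rule max.coboundedI2)
    with single show ?thesis by blast
  qed
  then have "improper_interval_coloring ?K ?d" "k_improper ?k ?K ?d"
    by (auto simp: improper_interval_coloring_def k_improper_def)
  with pos show ?thesis by (intro mu_int_le) auto
qed

end
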